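(* Let $\Omega$ be a set of states, let $\mathcal{E} \subseteq 2^{\Omega}$ be a complete algebra of events on $\Omega$, and let $K : \mathcal{E} \rightarrow \mathcal{E}$ be an operator satisfying Truth ($K(E) \subseteq E$ for all $E \in \mathcal{E}$) and Monotonicity (for all $E, F \in \mathcal{E}$, $E \subseteq F$ implies $K(E) \subseteq K(F)$). Then $K(\Omega \setminus K(\Omega)) = \emptyset$; that is, $K \neg K \Omega = \emptyset$.
   Context: A complete algebra of events on $\Omega$ is a family $\mathcal{E} \subseteq 2^{\Omega}$ that contains $\Omega$ and is closed under complementation in $\Omega$ and under arbitrary unions (hence also under arbitrary intersections). The epistemic (knowledge) operator is a map $K : \mathcal{E} \rightarrow \mathcal{E}$; one writes $KE = K(E)$ for the event that the agent knows that $E$ obtains, $\neg E = \Omega \setminus E$, and $\neg KE = \Omega \setminus KE$ for the event that the agent does not know that $E$ obtains. Iterations are written by juxtaposition, e.g. $K \neg K\Omega = K(\Omega \setminus K(\Omega))$. It is not assumed that $K\Omega = \Omega$ (Necessitation), nor any introspection axiom. *)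

theory Defs
  imports "HOL-Library.FuncSet"
begin

definition complete_algebra :: "'a set \<Rightarrow> 'a set set \<Rightarrow> bool" where
  "complete_algebra \<Omega> \<E> \<longleftrightarrow>
     \<E> \<subseteq> Pow \<Omega> \<and> \<Omega> \<in> \<E> \<and> (\<forall>E\<in>\<E>. \<Omega> - E \<in> \<E>) \<and> (\<forall>\<A>. \<A> \<subseteq> \<E> \<longrightarrow> \<Union>\<A> \<in> \<E>)"

end

theory Submission
  imports Defs
begin

text \<open>Knowing any event entails knowing the largest one, \<open>\<Omega>\<close>, by
  Monotonicity. By Truth, the event \<open>\<Omega> - K \<Omega>\<close> can be known only at states
  where \<open>\<Omega>\<close> is not known. A state in \<open>K (\<Omega> - K \<Omega>)\<close>
  would thus lie both in \<open>K \<Omega>\<close> and in its complement.\<close>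

theorem theorem2:
  fixes \<Omega> :: "'a set" and \<E> :: "'a set set" and K :: "'a set \<Rightarrow> 'a set"
  assumes algebra: "complete_algebra \<Omega> \<E>"
    and K_events: "K \<in> \<E> \<rightarrow> \<E>"
    and truth: "\<And>E. E \<in> \<E> \<Longrightarrow> K E \<subseteq> E"
    and monotonicity: "\<And>E F. E \<in> \<E> \<Longrightarrow> F \<in> \<E> \<Longrightarrow> E \<subseteq> F \<Longrightarrow> K E \<subseteq> K F"
  shows "K (\<Omega> - K \<Omega>) = {}"
proof -
  have \<Omega>: "\<Omega> \<in> \<E>" and compl: "\<And>E. E \<in> \<E> \<Longrightarrow> \<Omega> - E \<in> \<E>"
    using algebra by (auto simp: complete_algebra_def)
  \<comment> \<open>Truth and Monotonicity are assumed for members of \<open>\<E>\<close> only, so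
    this set must be an event before either applies to it.\<close>
  have unknown: "\<Omega> - K \<Omega> \<in> \<E>"
    using K_events \<Omega> compl by blast
  have "K (\<Omega> - K \<Omega>) \<subseteq> \<Omega> - K \<Omega>"
    using truth unknown .
  moreover have "K (\<Omega> - K \<Omega>) \<subseteq> K \<Omega>"
    using monotonicity unknown \<Omega> Diff_subset .
  ultimately show ?thesis
    by blast
qed

end
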